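(* Let $q$ be a prime power, let $\bm a\in\mathbb F_{q^2}^n$ have distinct entries, $\bm v\in(\mathbb F_{q^2}^* )^n$, $1\le k\le n-1$, and let $\mathcal C=GRS_k(\bm a,\bm v)$ be an $[n,k]_{q^2}$ GRS code with $l$-dimensional Hermitian hull, $0\le l\le k$. If $\bm g_k\in(\mathrm{Hull}_H(\mathcal C))^{\perp_H}$ (respectively, if $n<q^2$, $\bm a\in(\mathbb F_{q^2}^* )^n$ and $\bm g_{-1}\in(\mathrm{Hull}_H(\mathcal C))^{\perp_H}$), then there exists an $[n',k+1]_{q^2}$ MDS code with $(l+1)$-dimensional Hermitian hull for some $n'\in\{n,n+1\}$.
   Context: For a linear code $\mathcal C\subseteq\mathbb F_{q^2}^n$, $\mathcal C^{\perp_H}=\{\bm x:\sum_i y_ix_i^q=0\ \text{for all }\bm y\in\mathcal C\}$ and $\mathrm{Hull}_H(\mathcal C)=\mathcal C\cap\mathcal C^{\perp_H}$. For $\bm a$ with distinct entries and $\bm v\in(\mathbb F_{q^2}^* )^n$, the GRS code is $GRS_k(\bm a,\bm v)=\{(v_1f(a_1),\dots,v_nf(a_n)):f\in\mathbb F_{q^2}[x],\deg f\le k-1\}$, $1\le k\le n$. For an integer $i$, $\bm g_i=(v_1a_1^i,\dots,v_na_n^i)$ (with $0^0=1$; for $i=-1$ all $a_j$ must be nonzero). An $[n,k]$ code is MDS if its minimum distance is $n-k+1$. *)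

theory Defs
  imports
    "HOL-Library.Cardinality"
    "HOL-Library.Function_Algebras"
    "HOL-Computational_Algebra.Polynomial"
    "HOL-Number_Theory.Prime_Powers"
begin

text \<open>
  The space \<open>F^n\<close> is represented by the functions \<open>nat \<Rightarrow> F\<close> vanishing outside \<open>{..<n}\<close>, so that
  codes of different lengths live in one type and the generic linear algebra of
  \<^locale>\<open>vector_space\<close> (subspaces, dimension) applies to all of them.
\<close>

definition vscale :: "'a::field \<Rightarrow> (nat \<Rightarrow> 'a) \<Rightarrow> nat \<Rightarrow> 'a" where
  "vscale c x = (\<lambda>i. c * x i)"

global_interpretation fun_vs: vector_space "vscale :: 'a::field \<Rightarrow> (nat \<Rightarrow> 'a) \<Rightarrow> nat \<Rightarrow> 'a"
  by unfold_locales (auto simp: vscale_def plus_fun_def algebra_simps)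

definition vectors :: "nat \<Rightarrow> (nat \<Rightarrow> 'a::zero) set" where
  "vectors n = {x. \<forall>i\<ge>n. x i = 0}"

definition linear_code :: "nat \<Rightarrow> nat \<Rightarrow> (nat \<Rightarrow> 'a::field) set \<Rightarrow> bool" where
  "linear_code n k C \<longleftrightarrow> C \<subseteq> vectors n \<and> fun_vs.subspace C \<and> fun_vs.dim C = k"

definition hamming_dist :: "nat \<Rightarrow> (nat \<Rightarrow> 'a) \<Rightarrow> (nat \<Rightarrow> 'a) \<Rightarrow> nat" where
  "hamming_dist n x y = card {i. i < n \<and> x i \<noteq> y i}"

definition min_distance :: "nat \<Rightarrow> (nat \<Rightarrow> 'a) set \<Rightarrow> nat" where
  "min_distance n C = Inf {hamming_dist n x y | x y. x \<in> C \<and> y \<in> C \<and> x \<noteq> y}"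

text \<open>The subtraction below does not truncate, since \<open>linear_code n k C\<close> forces \<open>k \<le> n\<close>.\<close>

definition MDS_code :: "nat \<Rightarrow> nat \<Rightarrow> (nat \<Rightarrow> 'a::field) set \<Rightarrow> bool" where
  "MDS_code n k C \<longleftrightarrow> linear_code n k C \<and> min_distance n C = n - k + 1"

text \<open>The Hermitian notions are meant for a field \<open>'a\<close> with \<open>q\<^sup>2\<close> elements.\<close>

definition hermitian_dual :: "nat \<Rightarrow> nat \<Rightarrow> (nat \<Rightarrow> 'a::field) set \<Rightarrow> (nat \<Rightarrow> 'a) set" where
  "hermitian_dual q n C = {x \<in> vectors n. \<forall>y\<in>C. (\<Sum>i<n. y i * x i ^ q) = 0}"

definition hermitian_hull :: "nat \<Rightarrow> nat \<Rightarrow> (nat \<Rightarrow> 'a::field) set \<Rightarrow> (nat \<Rightarrow> 'a) set" where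
  "hermitian_hull q n C = C \<inter> hermitian_dual q n C"

text \<open>
  Only the entries of \<open>a\<close> and \<open>v\<close> with index below \<open>n\<close> matter in the next two definitions.
  As \<open>degree 0 = 0\<close>, the zero polynomial is included in \<open>GRS\<close>; \<open>k \<ge> 1\<close> is intended.
\<close>

definition GRS :: "nat \<Rightarrow> nat \<Rightarrow> (nat \<Rightarrow> 'a::field) \<Rightarrow> (nat \<Rightarrow> 'a) \<Rightarrow> (nat \<Rightarrow> 'a) set" where
  "GRS n k a v = {(\<lambda>i. if i < n then v i * poly f (a i) else 0) | f. degree f \<le> k - 1}"

text \<open>\<open>0 powi 0 = 1\<close>; for negative \<open>i\<close> the entries \<open>a j\<close>, \<open>j < n\<close>, are meant to be nonzero.\<close>

definition gvec :: "nat \<Rightarrow> (nat \<Rightarrow> 'a::field) \<Rightarrow> (nat \<Rightarrow> 'a) \<Rightarrow> int \<Rightarrow> nat \<Rightarrow> 'a" where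
  "gvec n a v i = (\<lambda>j. if j < n then v j * a j powi i else 0)"

end

theory Submission
  imports Defs
begin

text \<open>
  Let \<open>g\<close> be \<open>g\<^sub>k\<close> or \<open>g\<^sub>-\<^sub>1\<close>, so that \<open>C + \<langle>g\<rangle>\<close> is again a GRS code. Pairing with \<open>g\<close> is a functional on
  \<open>C\<close> that vanishes on the hull, which is the radical of the Hermitian form on \<open>C\<close>; hence it is
  represented by some \<open>c \<in> C\<close>, and \<open>h = g - c\<close> is orthogonal to \<open>C\<close>. If \<open>h\<close> is isotropic, then
  \<open>C + \<langle>h\<rangle>\<close> has hull \<open>Hull(C) + \<langle>h\<rangle>\<close> and length \<open>n\<close>. Otherwise \<open>\<langle>h, h\<rangle>\<close> is fixed by \<open>x \<mapsto> x\<^sup>q\<close>, so by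
  surjectivity of the norm there is \<open>u \<noteq> 0\<close> with \<open>u\<^bsup>q+1\<^esup> = -\<langle>h, h\<rangle>\<close>; appending the coordinate \<open>u\<close> to \<open>h\<close>
  (and \<open>0\<close> to the words of \<open>C\<close>) makes \<open>h\<close> isotropic in length \<open>n + 1\<close>. In both cases the new code
  is MDS: a nonzero word of \<open>C\<close> has fewer than \<open>k\<close> zeros among the first \<open>n\<close> coordinates, and any other
  word has at most \<open>k\<close> zeros there and a nonzero last coordinate if one was appended.
\<close>


section \<open>Conjugation and norm on a field with \<open>q\<^sup>2\<close> elements\<close>

lemma prime_CHAR_finite: "prime CHAR('a::{field,finite})"
  using prime_CHAR_semidom[where 'a='a] finite_imp_CHAR_pos[where 'a='a] by simp

text \<open>Translation by 1 permutes the field, so adding 1 to every element leaves the sum of all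
  elements unchanged; hence \<open>CARD('a)\<close> times 1 is 0.\<close>

lemma CHAR_dvd_CARD_finite: "CHAR('a::{field,finite}) dvd CARD('a)"
proof -
  have "bij (\<lambda>x::'a. x + 1)"
    by (rule bij_betwI[of _ _ _ "\<lambda>x. x - 1"]) auto
  then have "(\<Sum>x::'a\<in>UNIV. x + 1) = \<Sum>UNIV"
    by (rule sum.reindex_bij_betw)
  then have "of_nat CARD('a) = (0 :: 'a)"
    by (simp add: sum.distrib)
  then show ?thesis
    by (simp only: of_nat_eq_0_iff_char_dvd)
qed

text \<open>The characteristic is a prime divisor of a power of the prime below \<open>q\<close>,
  hence equal to that prime. This makes \<open>x ^ q\<close> an iterate of the Frobenius map, and so
  additive in \<open>x\<close>.\<close>

lemma field_size_power_CHAR: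
  assumes "primepow q" and "CARD('a::{field,finite}) = q\<^sup>2"
  obtains e where "q = CHAR('a) ^ e"
proof -
  obtain p e where pe: "prime p" "q = p ^ e"
    using assms(1) by (auto simp: primepow_def)
  have "CHAR('a) dvd p ^ (e * 2)"
    using CHAR_dvd_CARD_finite[where 'a='a] assms(2) pe(2) by (simp add: power_mult)
  then have "CHAR('a) = p"
    using prime_CHAR_finite[where 'a='a] pe(1)
    by (meson prime_dvd_power primes_dvd_imp_eq)
  then show thesis using pe(2) that by blast
qed

lemma conj_add:
  fixes x y :: "'a::{field,finite}"
  assumes "primepow q" and "CARD('a) = q\<^sup>2"
  shows "(x + y) ^ q = x ^ q + y ^ q"
  using field_size_power_CHAR[OF assms] freshmans_dream'[OF prime_CHAR_finite] by metis

lemma conj_sum: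
  fixes f :: "'b \<Rightarrow> 'a::{field,finite}"
  assumes "primepow q" and "CARD('a) = q\<^sup>2"
  shows "sum f A ^ q = (\<Sum>i\<in>A. f i ^ q)"
  using field_size_power_CHAR[OF assms] freshmans_dream_sum'[OF prime_CHAR_finite] by metis

lemma conj_uminus:
  fixes x :: "'a::{field,finite}"
  assumes "primepow q" and "CARD('a) = q\<^sup>2"
  shows "(- x) ^ q = - (x ^ q)"
proof -
  have "x ^ q + (- x) ^ q = (x + - x) ^ q"
    by (rule conj_add[OF assms, symmetric])
  also have "\<dots> = 0"
    using primepow_gt_Suc_0[OF assms(1)] by simp
  finally show ?thesis
    by (metis add.inverse_unique)
qed

text \<open>Multiplication by \<open>x\<close> permutes the nonzero elements; comparing their
  product before and after leaves this power of \<open>x\<close> as a factor 1.\<close>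

lemma field_power_card_minus_1:
  fixes x :: "'a::{field,finite}"
  assumes "x \<noteq> 0"
  shows "x ^ (CARD('a) - 1) = 1"
proof -
  let ?U = "UNIV - {0::'a}"
  have "bij_betw ((*) x) ?U ?U"
    using assms by (intro bij_betwI[of _ _ _ "\<lambda>y. y / x"]) auto
  then have "(\<Prod>y\<in>?U. x * y) = \<Prod>?U"
    by (rule prod.reindex_bij_betw)
  moreover have "(\<Prod>y\<in>?U. x * y) = x ^ (CARD('a) - 1) * \<Prod>?U"
    by (simp add: prod.distrib)
  moreover have "\<Prod>?U \<noteq> 0"
    by simp
  ultimately show ?thesis by simp
qed

lemma conj_conj:
  fixes x :: "'a::{field,finite}"
  assumes "primepow q" and "CARD('a) = q\<^sup>2"
  shows "(x ^ q) ^ q = x"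
proof (cases "x = 0")
  case False
  have "q\<^sup>2 = Suc (CARD('a) - 1)"
    using assms(2) zero_less_card_finite[where 'a='a] by linarith
  then have "x ^ q\<^sup>2 = x"
    using field_power_card_minus_1[OF False] by (metis mult_1_right power_Suc)
  then show ?thesis by (simp add: power2_eq_square power_mult)
qed (use primepow_gt_Suc_0[OF assms(1)] in simp)

lemma card_power_eq_bound:
  fixes t :: "'a::{field,finite}"
  assumes "m > 0"
  shows "card {x. x ^ m = t} \<le> m"
proof -
  define p where "p = monom 1 m - [:t:]"
  have "degree p = m"
    unfolding p_def using assms by (subst diff_conv_add_uminus, subst degree_add_eq_left) (auto simp: degree_monom_eq)
  moreover from this have "p \<noteq> 0" using assms by auto
  moreover have "{x. x ^ m = t} = {x. poly p x = 0}"
    by (auto simp: p_def poly_monom)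
  ultimately show ?thesis
    using card_poly_roots_bound[of p] by simp
qed

text \<open>By counting: the norm \<open>?N\<close> maps the \<open>(q - 1) * (q + 1)\<close>
  nonzero elements into \<open>?T\<close>, which has at most \<open>q - 1\<close> elements. Fibres
  have at most \<open>q + 1\<close> elements, so the image has at least \<open>q - 1\<close> and is
  all of \<open>?T\<close>.\<close>

lemma norm_surj:
  fixes t :: "'a::{field,finite}"
  assumes q: "primepow q" "CARD('a) = q\<^sup>2" and t: "t ^ q = t" "t \<noteq> 0"
  obtains x where "x ^ (q + 1) = t" "x \<noteq> 0"
proof -
  have q1: "q > 1" using primepow_gt_Suc_0[OF q(1)] by simp
  let ?U = "UNIV - {0::'a}" and ?T = "{t::'a. t ^ (q - 1) = 1}" and ?N = "\<lambda>x::'a. x ^ (q + 1)"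
  have eq: "CARD('a) - 1 = (q + 1) * (q - 1)"
    using q(2) by (simp add: power2_eq_square algebra_simps)
  have sub: "?N ` ?U \<subseteq> ?T"
    using field_power_card_minus_1[where 'a='a] unfolding eq power_mult by blast
  have "(q - 1) * (q + 1) = card ?U"
    using eq by (simp add: card_Diff_singleton mult.commute)
  also have "?U = (\<Union>s\<in>?N ` ?U. {x. ?N x = s} \<inter> ?U)" by auto
  also have "card \<dots> \<le> (\<Sum>s\<in>?N ` ?U. card ({x. ?N x = s} \<inter> ?U))"
    by (rule card_UN_le) simp
  also have "\<dots> \<le> (\<Sum>s\<in>?N ` ?U. q + 1)"
  proof (rule sum_mono)
    fix s
    have "card ({x. ?N x = s} \<inter> ?U) \<le> card {x. ?N x = s}" by (rule card_mono) auto
    also have "\<dots> \<le> q + 1" by (rule card_power_eq_bound) simp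
    finally show "card ({x. ?N x = s} \<inter> ?U) \<le> q + 1" .
  qed
  also have "\<dots> = card (?N ` ?U) * (q + 1)" by simp
  finally have "q - 1 \<le> card (?N ` ?U)"
    by (simp only: mult_le_cancel2)
  moreover have "card ?T \<le> q - 1"
    using q1 by (intro card_power_eq_bound) simp
  ultimately have "?N ` ?U = ?T"
    using sub by (intro card_seteq) auto
  moreover have "t \<in> ?T"
  proof -
    have "t * t ^ (q - 1) = t" using t(1) q1 by (metis One_nat_def Suc_pred less_trans power_Suc zero_less_one)
    then show ?thesis using t(2) by simp
  qed
  ultimately have "t \<in> ?N ` ?U" by simp
  then show thesis using that by blast
qed

section \<open>Finite subspaces\<close>

lemma vscale_apply: "vscale c x i = c * x i"
  by (simp add: vscale_def)

lemma finite_vectors: "finite (vectors n :: (nat \<Rightarrow> 'a::{zero,finite}) set)"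
  using finite_set_of_finite_funs[of "{..<n}" "UNIV :: 'a set" 0]
  by (rule rev_finite_subset) (auto simp: vectors_def)

lemma subspace_vectors: "fun_vs.subspace (vectors n)"
  by (auto simp: fun_vs.subspace_def vectors_def vscale_apply)

lemma mem_span_insert:
  assumes "fun_vs.subspace C"
  shows "x \<in> fun_vs.span (insert g C) \<longleftrightarrow> (\<exists>y\<in>C. \<exists>c. x = y + vscale c g)"
proof -
  have "fun_vs.span C = C" using assms by (simp add: fun_vs.span_eq_iff)
  then show ?thesis
    unfolding fun_vs.span_breakdown_eq by (metis add_diff_cancel_right' diff_add_cancel)
qed

text \<open>A basis of \<open>S\<close> stays independent when \<open>x\<close> is added. Finiteness
  of \<open>S\<close> makes the basis finite, so that \<open>card\<close> really grows by
  one.\<close>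

lemma dim_span_insert:
  assumes fin: "finite S" and sub: "fun_vs.subspace S" and x: "x \<notin> S"
  shows "fun_vs.dim (fun_vs.span (insert x S)) = Suc (fun_vs.dim S)"
proof -
  obtain B where B: "B \<subseteq> S" "fun_vs.independent B" "S \<subseteq> fun_vs.span B" "card B = fun_vs.dim S"
    by (rule fun_vs.basis_exists)
  have spanB: "fun_vs.span B = S"
    using B sub by (simp add: fun_vs.span_subspace)
  have "fun_vs.span S = S" using sub by (simp add: fun_vs.span_eq_iff)
  then have "fun_vs.span (insert x S) = fun_vs.span (insert x B)"
    unfolding fun_vs.span_insert spanB by (rule arg_cong)
  moreover have "fun_vs.independent (insert x B)"
    using B(2) x spanB by (simp add: fun_vs.independent_insertI)
  ultimately have "fun_vs.dim (fun_vs.span (insert x S)) = card (insert x B)"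
    by (metis fun_vs.dim_span_eq_card_independent)
  also have "\<dots> = Suc (card B)"
    using x B(1) fin by (subst card_insert_disjoint) (auto intro: finite_subset)
  finally show ?thesis using B(4) by simp
qed

lemma dim_zero_subspace: "fun_vs.dim {0} = 0"
  using fun_vs.dim_le_card[of "{0}" "{}"] by simp

section \<open>MDS codes\<close>

text \<open>Each condition \<open>x m = 0\<close> is one linear equation and lowers the dimension by
  at most one. This is the source of the Singleton bound.\<close>

lemma dim_le_dim_vanishing:
  fixes C :: "(nat \<Rightarrow> 'a::field) set"
  assumes "finite C" "fun_vs.subspace C"
  shows "fun_vs.dim C \<le> fun_vs.dim {x \<in> C. \<forall>i<m. x i = 0} + m"
proof (induction m)
  case (Suc m)
  let ?D = "\<lambda>m. {x \<in> C. \<forall>i<m. x i = 0}"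
  have sub: "fun_vs.subspace (?D m)" for m
    using assms(2) by (auto simp: fun_vs.subspace_def vscale_apply)
  have "fun_vs.dim (?D m) \<le> Suc (fun_vs.dim (?D (Suc m)))"
  proof (cases "?D m = ?D (Suc m)")
    case False
    then obtain z where z: "z \<in> ?D m" "z \<notin> ?D (Suc m)"
      by auto
    then have zm: "z m \<noteq> 0" by (auto simp: less_Suc_eq)
    have D_eq: "?D m = fun_vs.span (insert z (?D (Suc m)))"
    proof (rule set_eqI, rule iffI)
      fix x assume x: "x \<in> ?D m"
      \<comment> \<open>Chosen to cancel coordinate \<open>m\<close> of \<open>x\<close> against
        that of \<open>z\<close>.\<close>
      let ?c = "x m / z m"
      have "x - vscale ?c z \<in> ?D m"
        using sub x z(1) by (intro fun_vs.subspace_diff fun_vs.subspace_scale) auto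
      moreover have "(x - vscale ?c z) m = 0" using zm by (simp add: vscale_apply)
      ultimately have "x - vscale ?c z \<in> ?D (Suc m)" by (auto simp: less_Suc_eq)
      moreover have "x = (x - vscale ?c z) + vscale ?c z" by simp
      ultimately show "x \<in> fun_vs.span (insert z (?D (Suc m)))"
        using mem_span_insert[OF sub] by blast
    next
      fix x assume "x \<in> fun_vs.span (insert z (?D (Suc m)))"
      moreover have "insert z (?D (Suc m)) \<subseteq> ?D m" using z(1) by auto
      ultimately show "x \<in> ?D m"
        using fun_vs.span_minimal[OF _ sub] by blast
    qed
    have "finite (?D (Suc m))" using assms(1) by simp
    from dim_span_insert[OF this sub z(2)] show ?thesis
      unfolding D_eq by simp
  qed simp
  then show ?case using Suc by simp
qed simp

text \<open>The bound on zeros gives distance at least \<open>n - k\<close>. For equality, dimension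
  \<open>Suc k\<close> leaves a nonzero word vanishing on the first \<open>k\<close>
  coordinates.\<close>

lemma MDS_codeI:
  fixes C :: "(nat \<Rightarrow> 'a::field) set"
  assumes fin: "finite C" and code: "linear_code n (Suc k) C" and kn: "k < n"
    and zeros: "\<And>x. x \<in> C \<Longrightarrow> x \<noteq> 0 \<Longrightarrow> card {i. i < n \<and> x i = 0} \<le> k"
  shows "MDS_code n (Suc k) C"
proof -
  have sub: "fun_vs.subspace C" and vec: "C \<subseteq> vectors n" and dim: "fun_vs.dim C = Suc k"
    using code by (auto simp: linear_code_def)
  have weight: "hamming_dist n x y + card {i. i < n \<and> (x - y) i = 0} = n" for x y :: "nat \<Rightarrow> 'a"
  proof -
    have "hamming_dist n x y + card {i. i < n \<and> (x - y) i = 0}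
        = card ({i. i < n \<and> x i \<noteq> y i} \<union> {i. i < n \<and> (x - y) i = 0})"
      unfolding hamming_dist_def by (subst card_Un_disjoint) auto
    also have "{i. i < n \<and> x i \<noteq> y i} \<union> {i. i < n \<and> (x - y) i = 0} = {..<n}" by auto
    finally show ?thesis by simp
  qed
  have "{x \<in> C. \<forall>i<k. x i = 0} \<noteq> {0}"
  proof
    assume *: "{x \<in> C. \<forall>i<k. x i = 0} = {0}"
    show False
      using dim_le_dim_vanishing[OF fin sub, of k] dim unfolding * dim_zero_subspace by simp
  qed
  moreover have "0 \<in> C" using sub by (rule fun_vs.subspace_0)
  ultimately obtain z where z: "z \<in> C" "z \<noteq> 0" "\<forall>i<k. z i = 0" by auto
  have "card {..<k} \<le> card {i. i < n \<and> (z - 0) i = 0}"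
    using z(3) kn by (intro card_mono) auto
  then have "hamming_dist n z 0 \<le> n - k"
    using weight[of z 0] by simp
  moreover have lower: "n - k \<le> hamming_dist n x y" if "x \<in> C" "y \<in> C" "x \<noteq> y" for x y
    using zeros[of "x - y"] fun_vs.subspace_diff[OF sub that(1,2)] that(3) weight[of x y] by simp
  ultimately have "hamming_dist n z 0 = n - k"
    using z \<open>0 \<in> C\<close> by (intro antisym) auto
  then have "n - k \<in> {hamming_dist n x y | x y. x \<in> C \<and> y \<in> C \<and> x \<noteq> y}"
    using z(1,2) \<open>0 \<in> C\<close> by force
  then have "min_distance n C = n - k"
    unfolding min_distance_def using lower by (intro cInf_eq_minimum) auto
  then show ?thesis
    using code kn unfolding MDS_code_def by simp
qed


section \<open>The Hermitian form\<close>

text \<open>The form behind \<open>hermitian_dual\<close>, with the word of the dual in the second,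
  conjugated argument. It is defined on all functions, so that the forms of lengths \<open>n\<close>
  and \<open>n + 1\<close> can be compared.\<close>

definition hform :: "nat \<Rightarrow> nat \<Rightarrow> (nat \<Rightarrow> 'a::field) \<Rightarrow> (nat \<Rightarrow> 'a) \<Rightarrow> 'a" where
  "hform q n x y = (\<Sum>i<n. x i * y i ^ q)"

lemma hform_add_left: "hform q n (x + y) z = hform q n x z + hform q n y z"
  by (simp add: hform_def sum.distrib algebra_simps)

lemma hform_scale_left: "hform q n (vscale c x) z = c * hform q n x z"
  by (simp add: hform_def vscale_apply sum_distrib_left algebra_simps)

lemma hform_scale_right: "hform q n x (vscale c z) = c ^ q * hform q n x z"
  by (simp add: hform_def vscale_apply sum_distrib_left power_mult_distrib algebra_simps)

lemma hform_zero_right: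
  assumes "primepow q"
  shows "hform q n x 0 = 0"
  using primepow_gt_Suc_0[OF assms] by (simp add: hform_def power_0_left)

lemma hform_add_right:
  fixes x :: "nat \<Rightarrow> 'a::{field,finite}"
  assumes "primepow q" and "CARD('a) = q\<^sup>2"
  shows "hform q n x (y + z) = hform q n x y + hform q n x z"
  by (simp add: hform_def conj_add[OF assms] sum.distrib algebra_simps)

lemma hform_diff_right:
  fixes x :: "nat \<Rightarrow> 'a::{field,finite}"
  assumes "primepow q" and "CARD('a) = q\<^sup>2"
  shows "hform q n x (y - z) = hform q n x y - hform q n x z"
  using hform_add_right[OF assms, of n x "y - z" z] by (simp add: algebra_simps)

lemma hform_conj:
  fixes x :: "nat \<Rightarrow> 'a::{field,finite}"
  assumes "primepow q" and "CARD('a) = q\<^sup>2"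
  shows "hform q n x y ^ q = hform q n y x"
  by (simp add: hform_def conj_sum[OF assms] conj_conj[OF assms] power_mult_distrib mult.commute)

lemma hform_eq_0_commute:
  fixes x :: "nat \<Rightarrow> 'a::{field,finite}"
  assumes "primepow q" and "CARD('a) = q\<^sup>2"
  shows "hform q n x y = 0 \<longleftrightarrow> hform q n y x = 0"
  using hform_conj[OF assms, of n x y] primepow_gt_Suc_0[OF assms(1)] by (metis power_eq_0_iff not_less_zero zero_power gr0I)

text \<open>Vanishing of the left factor beyond \<open>n\<close> suffices, so \<open>y\<close> may
  carry an appended coordinate.\<close>

lemma hform_extend:
  assumes "x \<in> vectors n" and "n \<le> m"
  shows "hform q m x y = hform q n x y"
  unfolding hform_def using assms
  by (intro sum.mono_neutral_right) (auto simp: vectors_def)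

lemma mem_hermitian_hull_iff:
  assumes "C \<subseteq> vectors n"
  shows "x \<in> hermitian_hull q n C \<longleftrightarrow> x \<in> C \<and> (\<forall>y\<in>C. hform q n y x = 0)"
  using assms by (auto simp: hermitian_hull_def hermitian_dual_def hform_def)

lemma subspace_hermitian_hull:
  fixes C :: "(nat \<Rightarrow> 'a::{field,finite}) set"
  assumes q: "primepow q" "CARD('a) = q\<^sup>2" and C: "C \<subseteq> vectors n" "fun_vs.subspace C"
  shows "fun_vs.subspace (hermitian_hull q n C)"
proof (rule fun_vs.subspaceI)
  show "0 \<in> hermitian_hull q n C"
    using C by (simp add: mem_hermitian_hull_iff fun_vs.subspace_0 hform_zero_right[OF q(1)])
qed (use C in \<open>auto simp: mem_hermitian_hull_iff hform_add_right[OF q] hform_scale_right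
       fun_vs.subspace_add fun_vs.subspace_scale\<close>)

text \<open>
  This is the fact that a functional vanishing on the common kernel of finitely many functionals
  is a linear combination of them, for the functionals on \<open>C\<close> given by pairing with \<open>g\<close> and with
  the elements of \<open>B\<close>.
\<close>

lemma hform_representation:
  fixes C :: "(nat \<Rightarrow> 'a::{field,finite}) set"
  assumes q: "primepow q" "CARD('a) = q\<^sup>2" and sub: "fun_vs.subspace C"
    and "finite B" "B \<subseteq> C"
    and "\<And>y. y \<in> C \<Longrightarrow> \<forall>b\<in>B. hform q n y b = 0 \<Longrightarrow> hform q n y g = 0"
  shows "\<exists>c\<in>C. \<forall>y\<in>C. hform q n y g = hform q n y c"
  using assms(4-)
proof (induction B arbitrary: g rule: finite_induct)
  case empty
  have "\<forall>y\<in>C. hform q n y g = hform q n y 0"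
    unfolding hform_zero_right[OF q(1)] using empty.prems(2) by blast
  then show ?case using fun_vs.subspace_0[OF sub] by blast
next
  case (insert b B)
  have bC: "b \<in> C" and BC: "B \<subseteq> C" using insert.prems(1) by auto
  show ?case
  proof (cases "\<exists>z\<in>C. (\<forall>c\<in>B. hform q n z c = 0) \<and> hform q n z b \<noteq> 0")
    \<comment> \<open>Orthogonality to \<open>B\<close> already forces orthogonality to
      \<open>b\<close>, so the induction hypothesis applies to \<open>g\<close> itself.\<close>
    case False
    then show ?thesis
      using insert.prems(2) by (intro insert.IH[OF BC]) auto
  next
    case True
    then obtain z where z: "z \<in> C" "\<forall>c\<in>B. hform q n z c = 0" "hform q n z b \<noteq> 0" by blast
    \<comment> \<open>Pairing with \<open>z\<close> isolates \<open>b\<close> from \<open>B\<close>,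
      so it determines the coefficient of \<open>b\<close>. That coefficient is
      \<open>r ^ q\<close>, because it leaves the second argument as
      \<open>(r ^ q) ^ q = r\<close>.\<close>
    define r where "r = hform q n z g / hform q n z b"
    have r: "(r ^ q) ^ q = r" by (rule conj_conj[OF q])
    have "\<exists>c\<in>C. \<forall>y\<in>C. hform q n y (g - vscale (r ^ q) b) = hform q n y c"
    proof (rule insert.IH[OF BC])
      fix y assume y: "y \<in> C" "\<forall>c\<in>B. hform q n y c = 0"
      \<comment> \<open>Makes \<open>y + vscale t z\<close> orthogonal to \<open>b\<close> while
        keeping it orthogonal to \<open>B\<close>.\<close>
      define t where "t = - (hform q n y b / hform q n z b)"
      have "hform q n (y + vscale t z) g = 0"
      proof (rule insert.prems(2))
        show "y + vscale t z \<in> C"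
          using y(1) z(1) sub by (simp add: fun_vs.subspace_add fun_vs.subspace_scale)
        show "\<forall>c\<in>insert b B. hform q n (y + vscale t z) c = 0"
          unfolding hform_add_left hform_scale_left using y(2) z(2,3) by (auto simp: t_def)
      qed
      then show "hform q n y (g - vscale (r ^ q) b) = 0"
        unfolding hform_diff_right[OF q] hform_scale_right r hform_add_left hform_scale_left
        by (simp add: t_def r_def)
    qed
    then obtain c where c: "c \<in> C" "\<forall>y\<in>C. hform q n y (g - vscale (r ^ q) b) = hform q n y c"
      by blast
    show ?thesis
    proof (intro bexI ballI)
      show "c + vscale (r ^ q) b \<in> C"
        using c(1) bC sub by (simp add: fun_vs.subspace_add fun_vs.subspace_scale)
      show "hform q n y g = hform q n y (c + vscale (r ^ q) b)" if "y \<in> C" for y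
        using c(2) that by (simp add: hform_diff_right[OF q] hform_add_right[OF q] algebra_simps)
    qed
  qed
qed

text \<open>A word of \<open>C\<close> that pairs to zero with all of \<open>C\<close> lies in the
  hull, by symmetry of orthogonality, and so pairs to zero with \<open>g\<close>. Taking the whole
  finite code as \<open>B\<close> avoids choosing a basis.\<close>

lemma orthogonal_translate:
  fixes C :: "(nat \<Rightarrow> 'a::{field,finite}) set"
  assumes q: "primepow q" "CARD('a) = q\<^sup>2" and C: "C \<subseteq> vectors n" "fun_vs.subspace C"
    and g: "g \<in> hermitian_dual q n (hermitian_hull q n C)"
  obtains c where "c \<in> C" "\<And>y. y \<in> C \<Longrightarrow> hform q n y (g - c) = 0"
proof -
  have "finite C" using finite_subset[OF C(1) finite_vectors] .
  moreover have "hform q n y g = 0" if "y \<in> C" "\<forall>b\<in>C. hform q n y b = 0" for y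
  proof -
    have "y \<in> hermitian_hull q n C"
      using that C(1) hform_eq_0_commute[OF q] by (auto simp: mem_hermitian_hull_iff)
    then show ?thesis using g by (auto simp: hermitian_dual_def hform_def)
  qed
  ultimately obtain c where "c \<in> C" "\<forall>y\<in>C. hform q n y g = hform q n y c"
    using hform_representation[OF q C(2), of C n g] by blast
  then show thesis
    by (intro that[of c]) (auto simp: hform_diff_right[OF q])
qed

text \<open>Multiples of \<open>g\<close> contribute nothing to the form on the enlarged code
  (\<open>orth\<close>), so for \<open>y\<close> in \<open>C\<close> the word
  \<open>y + vscale c g\<close> is in the new hull exactly when \<open>y\<close> is in the old
  one.\<close>

lemma hermitian_hull_insert:
  fixes C :: "(nat \<Rightarrow> 'a::{field,finite}) set"
  assumes q: "primepow q" "CARD('a) = q\<^sup>2" and C: "C \<subseteq> vectors n" "fun_vs.subspace C"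
    and nm: "n \<le> m" and g: "g \<in> vectors m" "hform q m g g = 0"
      "\<And>y. y \<in> C \<Longrightarrow> hform q m y g = 0"
  shows "hermitian_hull q m (fun_vs.span (insert g C)) = fun_vs.span (insert g (hermitian_hull q n C))"
proof -
  let ?C = "fun_vs.span (insert g C)" and ?H = "hermitian_hull q n C"
  have "insert g C \<subseteq> vectors m" using C(1) nm g(1) by (auto simp: vectors_def)
  then have Cm: "?C \<subseteq> vectors m" by (rule fun_vs.span_minimal) (rule subspace_vectors)
  have gy: "hform q m g y = 0" if "y \<in> C" for y
    using g(3)[OF that] hform_eq_0_commute[OF q] by blast
  have ext: "hform q m y z = hform q n y z" if "y \<in> C" for y z
    using that C(1) nm by (intro hform_extend) auto
  have orth: "hform q m (y + vscale c g) (z + vscale d g) = hform q n y z"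
    if "y \<in> C" "z \<in> C" for y z c d
    using that gy g(2,3) ext
    by (simp add: hform_add_left hform_add_right[OF q] hform_scale_left hform_scale_right)
  note spanC = mem_span_insert[OF C(2)]
    and spanH = mem_span_insert[OF subspace_hermitian_hull[OF q C]]
  show ?thesis
  proof (rule set_eqI, rule iffI)
    fix x assume "x \<in> hermitian_hull q m ?C"
    then have x: "x \<in> ?C" "\<forall>y\<in>?C. hform q m y x = 0"
      using mem_hermitian_hull_iff[OF Cm] by auto
    obtain y c where y: "y \<in> C" "x = y + vscale c g" using x(1) spanC by blast
    have "hform q n z y = 0" if "z \<in> C" for z
    proof -
      have "z + vscale 0 g \<in> ?C" using that spanC by blast
      then show ?thesis using x(2) orth[OF that y(1)] y(2) by metis
    qed
    then have "y \<in> ?H" using y(1) mem_hermitian_hull_iff[OF C(1)] by blast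
    then show "x \<in> fun_vs.span (insert g ?H)" using y(2) spanH by blast
  next
    fix x assume "x \<in> fun_vs.span (insert g ?H)"
    then obtain y c where y: "y \<in> ?H" "x = y + vscale c g" using spanH by blast
    then have yC: "y \<in> C" "\<forall>z\<in>C. hform q n z y = 0"
      using mem_hermitian_hull_iff[OF C(1)] by auto
    have "x \<in> ?C" using yC(1) y(2) spanC by blast
    moreover have "hform q m z x = 0" if "z \<in> ?C" for z
    proof -
      obtain w d where "w \<in> C" "z = w + vscale d g" using \<open>z \<in> ?C\<close> spanC by blast
      then show ?thesis using orth yC y(2) by simp
    qed
    ultimately show "x \<in> hermitian_hull q m ?C"
      using mem_hermitian_hull_iff[OF Cm] by blast
  qed
qed

section \<open>Enlarging the hull\<close>

text \<open>Serves both choices of \<open>g\<close>: beyond duality, only the two bounds on zeros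
  are needed. The strict one leaves room for the 0 appended to words of \<open>C\<close>.\<close>

lemma MDS_extension:
  fixes C :: "(nat \<Rightarrow> 'a::{field,finite}) set"
  assumes q: "primepow q" "CARD('a) = q\<^sup>2"
    and code: "linear_code n k C" and kn: "k < n"
    and g: "g \<in> hermitian_dual q n (hermitian_hull q n C)"
    and zC: "\<And>y. y \<in> C \<Longrightarrow> y \<noteq> 0 \<Longrightarrow> card {i. i < n \<and> y i = 0} < k"
    and zg: "\<And>y. y \<in> C \<Longrightarrow> card {i. i < n \<and> (y + g) i = 0} \<le> k"
  shows "\<exists>n'\<in>{n, n + 1}. \<exists>C' :: (nat \<Rightarrow> 'a) set. MDS_code n' (k + 1) C' \<and>
    fun_vs.dim (hermitian_hull q n' C') = fun_vs.dim (hermitian_hull q n C) + 1"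
proof -
  have C: "C \<subseteq> vectors n" "fun_vs.subspace C" and dimC: "fun_vs.dim C = k"
    using code by (auto simp: linear_code_def)
  have finC: "finite C" using finite_subset[OF C(1) finite_vectors] .
  have gn: "g \<in> vectors n" using g by (simp add: hermitian_dual_def)
  obtain c0 where c0: "c0 \<in> C" "\<And>y. y \<in> C \<Longrightarrow> hform q n y (g - c0) = 0"
    using orthogonal_translate[OF q C g] by blast
  have hn: "g - c0 \<in> vectors n"
    using gn c0(1) C(1) by (auto intro: fun_vs.subspace_diff[OF subspace_vectors])
  \<comment> \<open>Covers both lengths at once: \<open>h\<close> is \<open>g - c0\<close> with or
    without a nonzero appended coordinate.\<close>
  have main: ?thesis
    if m: "m \<in> {n, n + 1}" and h: "h \<in> vectors m" "\<And>i. i < n \<Longrightarrow> h i = g i - c0 i"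
      and hh: "hform q m h h = 0" and last: "m = n + 1 \<Longrightarrow> h n \<noteq> 0" for m h
  proof -
    let ?C = "fun_vs.span (insert h C)"
    have nm: "n \<le> m" using m by auto
    have zh: "card {i. i < m \<and> (y + vscale c h) i = 0} \<le> k" if y: "y \<in> C" and c: "c \<noteq> 0" for y c
    proof -
      \<comment> \<open>On the first \<open>n\<close> coordinates, \<open>y + vscale c h\<close> is
        \<open>c\<close> times \<open>?y + g\<close>, so the bound \<open>zg\<close>
        applies.\<close>
      let ?y = "vscale (1 / c) y - c0"
      have "?y \<in> C"
        using y c0(1) C(2) by (simp add: fun_vs.subspace_diff fun_vs.subspace_scale)
      have "(?y + g) i = 0 \<and> i < n" if i: "i < m" "(y + vscale c h) i = 0" for i
      proof -
        have "i < n"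
        proof (rule ccontr)
          assume "\<not> i < n"
          then have "i = n" "m = n + 1" using i(1) m by auto
          moreover have "y n = 0" using y C(1) by (auto simp: vectors_def)
          ultimately show False using i(2) last c by (simp add: vscale_apply)
        qed
        moreover have "y i + c * (g i - c0 i) = 0"
          using i(2) h(2)[OF \<open>i < n\<close>] by (simp add: vscale_apply)
        then have "(?y + g) i = 0"
          using c by (simp add: vscale_apply field_simps)
        ultimately show ?thesis by simp
      qed
      then have "card {i. i < m \<and> (y + vscale c h) i = 0} \<le> card {i. i < n \<and> (?y + g) i = 0}"
        by (intro card_mono) auto
      then show ?thesis using zg[OF \<open>?y \<in> C\<close>] by simp
    qed
    have hC: "h \<notin> C"
    proof
      assume "h \<in> C"
      \<comment> \<open>The sum of \<open>- h\<close> and \<open>h\<close> would be a word covered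
        by \<open>zh\<close> with zeros in all \<open>m > k\<close> positions.\<close>
      then have "- h \<in> C" by (rule fun_vs.subspace_neg[OF C(2)])
      from zh[OF this, of 1] have "m \<le> k" by (simp add: vscale_apply)
      then show False using nm kn by simp
    qed
    have Cm: "?C \<subseteq> vectors m"
      using C(1) nm h(1) by (intro fun_vs.span_minimal subspace_vectors) (auto simp: vectors_def)
    have "linear_code m (Suc k) ?C"
      using Cm dim_span_insert[OF finC C(2) hC] dimC
      by (simp add: linear_code_def del: fun_vs.dim_span)
    then have "MDS_code m (Suc k) ?C"
    proof (rule MDS_codeI[rotated])
      show "finite ?C" using finite_subset[OF Cm finite_vectors] .
      show "k < m" using nm kn by simp
      fix x assume x: "x \<in> ?C" "x \<noteq> 0"
      then obtain y c where y: "y \<in> C" "x = y + vscale c h"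
        using mem_span_insert[OF C(2)] by blast
      show "card {i. i < m \<and> x i = 0} \<le> k"
      proof (cases "c = 0")
        case True
        then have "x = y" using y(2) by simp
        \<comment> \<open>The index \<open>n\<close> accounts for the appended zero when
          \<open>m = n + 1\<close>.\<close>
        have "card {i. i < m \<and> x i = 0} \<le> card (insert n {i. i < n \<and> x i = 0})"
          using m by (intro card_mono) auto
        also have "\<dots> \<le> Suc (card {i. i < n \<and> x i = 0})" by (simp add: card_insert_if)
        also have "\<dots> \<le> k" using zC y(1) x(2) \<open>x = y\<close> by (simp add: Suc_leI)
        finally show ?thesis .
      qed (use zh y in simp)
    qed
    moreover have "fun_vs.dim (hermitian_hull q m ?C) = Suc (fun_vs.dim (hermitian_hull q n C))"
    proof -
      have orth: "hform q m y h = 0" if "y \<in> C" for y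
      proof -
        have "hform q m y h = hform q n y h"
          using that C(1) nm by (intro hform_extend) auto
        also have "\<dots> = hform q n y (g - c0)" using h(2) by (simp add: hform_def)
        finally show ?thesis using c0(2) that by simp
      qed
      have sub: "hermitian_hull q n C \<subseteq> C" by (simp add: hermitian_hull_def)
      have "hermitian_hull q m ?C = fun_vs.span (insert h (hermitian_hull q n C))"
        by (rule hermitian_hull_insert[OF q C nm h(1) hh orth])
      then show ?thesis
        using dim_span_insert[OF finite_subset[OF sub finC] subspace_hermitian_hull[OF q C], of h]
          sub hC by auto
    qed
    ultimately show ?thesis using m by (metis Suc_eq_plus1)
  qed
  define s where "s = hform q n (g - c0) (g - c0)"
  show ?thesis
  proof (cases "s = 0")
    case True
    then show ?thesis by (intro main[of n "g - c0"] hn) (auto simp: s_def)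
  next
    case False
    \<comment> \<open>Conjugation swaps the arguments of the form, and in \<open>s\<close> they are
      equal; so \<open>- s\<close> qualifies as a norm.\<close>
    have "(- s) ^ q = - s"
      using hform_conj[OF q] by (simp add: conj_uminus[OF q] s_def)
    then obtain u where u: "u ^ (q + 1) = - s" "u \<noteq> 0"
      using norm_surj[OF q] False by (metis neg_equal_0_iff_equal)
    let ?h = "(g - c0)(n := u)"
    have "hform q (n + 1) ?h ?h = (\<Sum>i<n. ?h i * ?h i ^ q) + u ^ (q + 1)"
      unfolding hform_def by simp
    also have "(\<Sum>i<n. ?h i * ?h i ^ q) = s"
      unfolding s_def hform_def by (intro sum.cong) auto
    finally have "hform q (n + 1) ?h ?h = 0" unfolding u(1) by (simp only: add.right_inverse)
    then show ?thesis
      using hn u(2) by (intro main[of "n + 1" ?h]) (auto simp: vectors_def)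
  qed
qed

section \<open>Generalized Reed-Solomon codes\<close>

definition eval_word :: "nat \<Rightarrow> (nat \<Rightarrow> 'a::field) \<Rightarrow> (nat \<Rightarrow> 'a) \<Rightarrow> 'a poly \<Rightarrow> nat \<Rightarrow> 'a" where
  "eval_word n a v f = (\<lambda>i. if i < n then v i * poly f (a i) else 0)"

lemma eval_word_add: "eval_word n a v (f + g) = eval_word n a v f + eval_word n a v g"
  by (auto simp: eval_word_def algebra_simps)

lemma eval_word_smult: "eval_word n a v (smult c f) = vscale c (eval_word n a v f)"
  by (auto simp: eval_word_def vscale_apply)

lemma card_roots_le:
  fixes a :: "nat \<Rightarrow> 'a::field"
  assumes "inj_on a {..<n}" "f \<noteq> 0" "degree f \<le> d"
  shows "card {i. i < n \<and> poly f (a i) = 0} \<le> d"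
proof -
  have "card {i. i < n \<and> poly f (a i) = 0} \<le> card {x. poly f x = 0}"
    using assms(1,2) by (intro card_inj_on_le[of a] poly_roots_finite) (auto simp: inj_on_def)
  then show ?thesis
    using card_poly_roots_bound[OF assms(2)] assms(3) by linarith
qed

lemma degree_less_iff_coeff: "k > 0 \<Longrightarrow> degree f \<le> k - 1 \<longleftrightarrow> (\<forall>i\<ge>k. coeff f i = 0)"
  by (metis One_nat_def Suc_leI Suc_pred coeff_eq_0 degree_le le_imp_less_Suc less_le_trans not_less)

text \<open>Each new monomial raises the dimension by one: otherwise, for some \<open>k < n\<close>,
  a nonzero polynomial of degree at most \<open>k\<close> would vanish at \<open>n\<close> distinct
  points.\<close>

lemma linear_code_GRS:
  fixes a v :: "nat \<Rightarrow> 'a::{field,finite}"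
  assumes a: "inj_on a {..<n}" and v: "\<forall>i<n. v i \<noteq> 0" and k: "1 \<le> k" "k \<le> n"
  shows "linear_code n k (GRS n k a v)"
proof -
  \<comment> \<open>Stated by coefficients so that the induction can start at 0: there only the zero
    polynomial remains, while \<open>degree f \<le> k - 1\<close> would truncate and admit
    constants.\<close>
  define G where "G k = eval_word n a v ` {f. \<forall>i\<ge>k. coeff f i = 0}" for k
  have GRS: "GRS n k a v = G k"
    using k(1) degree_less_iff_coeff[of k] by (auto simp: GRS_def G_def eval_word_def[abs_def])
  have vec: "G k \<subseteq> vectors n" for k
    by (auto simp: G_def eval_word_def vectors_def)
  have sub: "fun_vs.subspace (G k)" for k
  proof (rule fun_vs.subspaceI)
    have "0 = eval_word n a v 0" by (auto simp: eval_word_def)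
    then show "0 \<in> G k" by (auto simp: G_def)
  qed (auto simp: G_def simp flip: eval_word_add eval_word_smult)
  have "fun_vs.dim (G k) = k" if "k \<le> n" for k
    using that
  proof (induction k)
    case 0
    have "{f. \<forall>i\<ge>0. coeff f i = 0} = {0 :: 'a poly}" by (auto simp: poly_eq_iff)
    then have "G 0 = {0}" by (auto simp: G_def eval_word_def)
    then show ?case by (simp add: dim_zero_subspace)
  next
    case (Suc k)
    let ?g = "eval_word n a v (monom 1 k)"
    have "?g \<notin> G k"
    proof
      assume "?g \<in> G k"
      then obtain f where f: "\<forall>i\<ge>k. coeff f i = 0" "?g = eval_word n a v f" by (auto simp: G_def)
      let ?p = "monom 1 k - f"
      have "coeff ?p k = 1" using f(1) by simp
      then have "?p \<noteq> 0" by auto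
      moreover have "degree ?p \<le> k" using f(1) by (intro degree_le) auto
      ultimately have "card {i. i < n \<and> poly ?p (a i) = 0} \<le> k" by (rule card_roots_le[OF a])
      moreover have "{i. i < n \<and> poly ?p (a i) = 0} = {..<n}"
        using f(2) v by (auto simp: eval_word_def fun_eq_iff split: if_splits)
      ultimately show False using Suc.prems by simp
    qed
    moreover have "G (Suc k) = fun_vs.span (insert ?g (G k))"
    proof (rule set_eqI, rule iffI)
      fix x assume "x \<in> G (Suc k)"
      then obtain f where f: "\<forall>i\<ge>Suc k. coeff f i = 0" "x = eval_word n a v f" by (auto simp: G_def)
      let ?f = "f - smult (coeff f k) (monom 1 k)"
      have "eval_word n a v ?f \<in> G k"
        unfolding G_def using f(1) by (intro imageI) (auto simp: Suc_le_eq)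
      moreover have "x = eval_word n a v ?f + vscale (coeff f k) ?g"
        unfolding f(2) by (simp flip: eval_word_add eval_word_smult)
      ultimately show "x \<in> fun_vs.span (insert ?g (G k))"
        using mem_span_insert[OF sub] by blast
    next
      fix x assume "x \<in> fun_vs.span (insert ?g (G k))"
      then obtain f c where "\<forall>i\<ge>k. coeff f i = 0" "x = eval_word n a v f + vscale c ?g"
        using mem_span_insert[OF sub] by (auto simp: G_def)
      then show "x \<in> G (Suc k)"
        by (auto simp: G_def simp flip: eval_word_add eval_word_smult)
    qed
    ultimately show ?case
      using dim_span_insert[OF finite_subset[OF vec finite_vectors] sub] Suc by simp
  qed
  then show ?thesis
    unfolding GRS linear_code_def using vec sub k(2) by blast
qed

theorem corollary7:
  fixes q n k l :: nat
    and a v :: "nat \<Rightarrow> 'a::{field,finite}"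
    and C :: "(nat \<Rightarrow> 'a) set"
  assumes "primepow q"
    and "CARD('a) = q\<^sup>2"
    and "inj_on a {..<n}"
    and "\<forall>i<n. v i \<noteq> 0"
    and "1 \<le> k" and "k \<le> n - 1"
    and "C = GRS n k a v"
    and "l \<le> k"
    and "fun_vs.dim (hermitian_hull q n C) = l"
    and "gvec n a v (int k) \<in> hermitian_dual q n (hermitian_hull q n C) \<or>
         (n < q\<^sup>2 \<and> (\<forall>i<n. a i \<noteq> 0) \<and>
          gvec n a v (- 1) \<in> hermitian_dual q n (hermitian_hull q n C))"
  shows "\<exists>n'\<in>{n, n + 1}. \<exists>C' :: (nat \<Rightarrow> 'a) set.
           MDS_code n' (k + 1) C' \<and> fun_vs.dim (hermitian_hull q n' C') = l + 1"
proof -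
  have kn: "k < n" using assms(5,6) by linarith
  have code: "linear_code n k C"
    unfolding assms(7) using linear_code_GRS assms(3-5) kn by (metis less_imp_le)
  have C: "\<exists>f. y = eval_word n a v f \<and> degree f \<le> k - 1" if "y \<in> C" for y
    using that assms(7) by (auto simp: GRS_def eval_word_def)
  have zC: "card {i. i < n \<and> y i = 0} < k" if y: "y \<in> C" "y \<noteq> 0" for y
  proof -
    obtain f where f: "y = eval_word n a v f" "degree f \<le> k - 1" using C[OF y(1)] by blast
    then have "f \<noteq> 0" using y(2) by (auto simp: eval_word_def)
    moreover have "{i. i < n \<and> y i = 0} = {i. i < n \<and> poly f (a i) = 0}"
      using f(1) assms(4) by (auto simp: eval_word_def)
    ultimately show ?thesis
      using card_roots_le[OF assms(3) _ f(2)] assms(5) by simp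
  qed
  note ext = MDS_extension[OF assms(1,2) code kn _ zC, unfolded assms(9)]
  from assms(10) show ?thesis
  proof (elim disjE conjE)
    assume g: "gvec n a v (int k) \<in> hermitian_dual q n (hermitian_hull q n C)"
    show ?thesis
    proof (rule ext[OF g])
      fix y assume "y \<in> C"
      then obtain f where f: "y = eval_word n a v f" "degree f \<le> k - 1" using C by blast
      \<comment> \<open>The polynomial evaluated by the sum word; it is nonzero because
        \<open>f\<close> has no term of degree \<open>k\<close>.\<close>
      let ?p = "f + monom 1 k"
      have "coeff ?p k = 1" using f(2) assms(5) by (simp add: coeff_eq_0)
      then have "?p \<noteq> 0" by (metis coeff_0 zero_neq_one)
      moreover have "degree ?p \<le> k"
        using f(2) by (intro degree_add_le) (auto simp: degree_monom_eq)
      moreover have "{i. i < n \<and> (y + gvec n a v (int k)) i = 0} = {i. i < n \<and> poly ?p (a i) = 0}"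
        using f(1) assms(4) by (auto simp: eval_word_def gvec_def poly_monom simp flip: distrib_left)
      ultimately show "card {i. i < n \<and> (y + gvec n a v (int k)) i = 0} \<le> k"
        using card_roots_le[OF assms(3), of ?p k] by (simp only: not_False_eq_True)
    qed
  next
    assume a: "\<forall>i<n. a i \<noteq> 0"
      and g: "gvec n a v (- 1) \<in> hermitian_dual q n (hermitian_hull q n C)"
    show ?thesis
    proof (rule ext[OF g])
      fix y assume "y \<in> C"
      then obtain f where f: "y = eval_word n a v f" "degree f \<le> k - 1" using C by blast
      \<comment> \<open>This is \<open>1 + x * f\<close>, the numerator of \<open>f + 1 / x\<close>;
        its constant term 1 makes it nonzero.\<close>
      let ?p = "pCons 1 f"
      have "degree ?p \<le> k"
        using f(2) assms(5) degree_pCons_le[of 1 f] by linarith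
      moreover have "?p \<noteq> 0" by simp
      moreover have "(y + gvec n a v (- 1)) i = v i / a i * poly ?p (a i)" if "i < n" for i
        using f(1) a that by (simp add: eval_word_def gvec_def power_int_minus field_simps)
      then have "{i. i < n \<and> (y + gvec n a v (- 1)) i = 0} = {i. i < n \<and> poly ?p (a i) = 0}"
        using a assms(4) by auto
      ultimately show "card {i. i < n \<and> (y + gvec n a v (- 1)) i = 0} \<le> k"
        using card_roots_le[OF assms(3), of ?p k] by (simp only: not_False_eq_True)
    qed
  qed
qed

end
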